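(* Let $X$ be a Banach space and let $(A_m)_{m\in\mathbb{Z}}$ be a sequence of bounded and invertible linear operators on $X$ that admits a strong partial exponential dichotomy and satisfies $\sup_{m\in\mathbb{Z}}\{\|A_m\|,\|A_m^{-1}\|\}<\infty$. Let $L>0$ be a constant such that the linear system $x_{n+1}=A_nx_n$, $n\in\mathbb{Z}$, has the $l^\infty$-Lipschitz quasi-shadowing property with constant $L$. Then, for every sufficiently small $\varepsilon>0$ and for every sufficiently small $c>0$, the following holds with $\delta:=L\varepsilon$. Let $f_n\colon X\to X$, $n\in\mathbb{Z}$, be maps such that $$\|f_n(x)-f_n(y)\|\le c\|x-y\|\quad\text{and}\quad \sup_{x\in X}\|f_n(x)\|\le\delta\qquad\text{for all } n\in\mathbb{Z},\ x,y\in X,$$ and let $F_n:=A_n+f_n$. Then there are continuous maps $h_m\colon X\to X$ and $\tau_m\colon X\to E_m^c$, $m\in\mathbb{Z}$, such that for each $m\in\mathbb{Z}$ $$h_{m+1}\circ F_m=A_m\circ h_m+\tau_{m+1}\circ F_m,$$ with $$\sup_{x\in X}\|h_m(x)-x\|\le\varepsilon\quad\text{and}\quad\sup_{x\in X}\|\tau_m(x)\|\le\varepsilon .$$ Moreover, $h_m(x)-x\in E_m^{s,u}$ for all $m\in\mathbb{Z}$ and $x\in X$.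
   Context: Here "for every sufficiently small $\varepsilon$ and for every sufficiently small $c$" means: there is $\varepsilon_0>0$ such that for each $\varepsilon\in(0,\varepsilon_0]$ there is $c_0>0$ such that the assertion holds for all $c\in(0,c_0]$; in particular $c$ is taken small enough that every $F_n$ is a homeomorphism of $X$. Strong partial exponential dichotomy. For invertible $A_m$ put $\mathcal{A}(m,n)=A_{m-1}\cdots A_n$ for $m>n$, $\mathcal{A}(n,n)=\mathrm{Id}$, and $\mathcal{A}(m,n)=(\mathcal{A}(n,m))^{-1}$ for $m<n$. The sequence $(A_m)_{m\in\mathbb{Z}}$ of bounded invertible operators admits a strong partial exponential dichotomy if there are projections $P_n^i$ ($n\in\mathbb{Z}$, $i\in\{1,2,3\}$) on $X$ with $P_n^1+P_n^2+P_n^3=\mathrm{Id}$, $A_nP_n^i=P_{n+1}^iA_n$, and constants $D>0$, $0\le a<b$, $0\le c'<d$ such that $\|\mathcal{A}(m,n)P_n^1\|\le De^{-d(m-n)}$ and $\|\mathcal{A}(m,n)P_n^3\|\le De^{a(m-n)}$ for $m\ge n$, and $\|\mathcal{A}(m,n)P_n^2\|\le De^{-b(n-m)}$ and $\|\mathcal{A}(m,n)P_n^3\|\le De^{c'(n-m)}$ for $m\le n$. Splitting. $E_n^s=\operatorname{Im}P_n^1$, $E_n^u=\operatorname{Im}P_n^2$, $E_n^c=\operatorname{Im}P_n^3$, $E_n^{s,u}=E_n^s\oplus E_n^u$. For $x_n\in X$ write $x_n^c=P_n^3x_n$ and $x_n^{s,u}=x_n-x_n^c$. For a bounded sequence $\mathbf{x}=(x_n)_{n\in\mathbb{Z}}$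 in $X$ put $\|\mathbf{x}\|_\infty'=\max\{\sup_n\|x_n^c\|,\sup_n\|x_n^{s,u}\|\}$. The linear system $x_{n+1}=A_nx_n$ has the $l^\infty$-Lipschitz quasi-shadowing property with constant $L>0$ if for every $\varepsilon>0$ and every sequence $(y_n)_{n\in\mathbb{Z}}\subset X$ with $\sup_{n}\|y_{n+1}-A_ny_n\|\le L\varepsilon$ there is a bounded sequence $\mathbf{z}=(z_n)_{n\in\mathbb{Z}}$ in $X$ with $\|\mathbf{z}\|_\infty'\le\varepsilon$ such that $x_{n+1}=A_nx_n+z_{n+1}^c$ for all $n\in\mathbb{Z}$, where $x_n=y_n+z_n^{s,u}$. (Under the dichotomy assumption such an $L$ exists.) *)

theory Defs
  imports "HOL-Analysis.Analysis"
begin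

definition blinfun_invertible :: "('a::real_normed_vector \<Rightarrow>\<^sub>L 'a) \<Rightarrow> bool" where
  "blinfun_invertible T \<longleftrightarrow> (\<exists>S. S o\<^sub>L T = id_blinfun \<and> T o\<^sub>L S = id_blinfun)"

text \<open>The inverse in the algebra of bounded operators; it is only meaningful if \<open>T\<close> is invertible there.\<close>

definition blinfun_inv :: "('a::real_normed_vector \<Rightarrow>\<^sub>L 'a) \<Rightarrow> ('a \<Rightarrow>\<^sub>L 'a)" where
  "blinfun_inv T = (THE S. S o\<^sub>L T = id_blinfun \<and> T o\<^sub>L S = id_blinfun)"

text \<open>\<open>iterate_from A n k\<close> is the product \<open>A (n + k - 1) \<cdots> A n\<close> of \<open>k\<close> factors.\<close>

primrec iterate_from ::
    "(int \<Rightarrow> 'a::real_normed_vector \<Rightarrow>\<^sub>L 'a) \<Rightarrow> int \<Rightarrow> nat \<Rightarrow> ('a \<Rightarrow>\<^sub>L 'a)" where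
  "iterate_from A n 0 = id_blinfun"
| "iterate_from A n (Suc k) = A (n + int k) o\<^sub>L iterate_from A n k"

definition evol ::
    "(int \<Rightarrow> 'a::real_normed_vector \<Rightarrow>\<^sub>L 'a) \<Rightarrow> int \<Rightarrow> int \<Rightarrow> ('a \<Rightarrow>\<^sub>L 'a)" where
  "evol A m n =
     (if n \<le> m then iterate_from A n (nat (m - n))
      else blinfun_inv (iterate_from A m (nat (n - m))))"

text \<open>The projections are parameters rather than existentially quantified, because the splitting
  they induce is referred to afterwards; \<open>P1\<close>, \<open>P2\<close>, \<open>P3\<close> are the stable, unstable and centre
  projections. Their mutual orthogonality follows from idempotence and \<open>P1 + P2 + P3 = Id\<close>.\<close>

definition strong_partial_dichotomy ::
    "(int \<Rightarrow> 'a::real_normed_vector \<Rightarrow>\<^sub>L 'a) \<Rightarrow> (int \<Rightarrow> 'a \<Rightarrow>\<^sub>L 'a) \<Rightarrow> (int \<Rightarrow> 'a \<Rightarrow>\<^sub>L 'a) \<Rightarrow>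
     (int \<Rightarrow> 'a \<Rightarrow>\<^sub>L 'a) \<Rightarrow> bool" where
  "strong_partial_dichotomy A P1 P2 P3 \<longleftrightarrow>
     (\<forall>n. P1 n o\<^sub>L P1 n = P1 n \<and> P2 n o\<^sub>L P2 n = P2 n \<and> P3 n o\<^sub>L P3 n = P3 n) \<and>
     (\<forall>n. P1 n + P2 n + P3 n = id_blinfun) \<and>
     (\<forall>n. A n o\<^sub>L P1 n = P1 (n + 1) o\<^sub>L A n \<and>
          A n o\<^sub>L P2 n = P2 (n + 1) o\<^sub>L A n \<and>
          A n o\<^sub>L P3 n = P3 (n + 1) o\<^sub>L A n) \<and>
     (\<exists>(D::real) (a::real) (b::real) (c::real) (d::real).
        D > 0 \<and> 0 \<le> a \<and> a < b \<and> 0 \<le> c \<and> c < d \<and>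
        (\<forall>m n. m \<ge> n \<longrightarrow>
           norm (evol A m n o\<^sub>L P1 n) \<le> D * exp (- d * real_of_int (m - n)) \<and>
           norm (evol A m n o\<^sub>L P3 n) \<le> D * exp (a * real_of_int (m - n))) \<and>
        (\<forall>m n. m \<le> n \<longrightarrow>
           norm (evol A m n o\<^sub>L P2 n) \<le> D * exp (- b * real_of_int (n - m)) \<and>
           norm (evol A m n o\<^sub>L P3 n) \<le> D * exp (c * real_of_int (n - m))))"

definition centre_part :: "(int \<Rightarrow> 'a::real_normed_vector \<Rightarrow>\<^sub>L 'a) \<Rightarrow> int \<Rightarrow> 'a \<Rightarrow> 'a" where
  "centre_part P3 n x = blinfun_apply (P3 n) x"

definition su_part :: "(int \<Rightarrow> 'a::real_normed_vector \<Rightarrow>\<^sub>L 'a) \<Rightarrow> int \<Rightarrow> 'a \<Rightarrow> 'a" where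
  "su_part P3 n x = x - centre_part P3 n x"

definition stable_space :: "(int \<Rightarrow> 'a::real_normed_vector \<Rightarrow>\<^sub>L 'a) \<Rightarrow> int \<Rightarrow> 'a set" where
  "stable_space P1 n = range (blinfun_apply (P1 n))"

definition unstable_space :: "(int \<Rightarrow> 'a::real_normed_vector \<Rightarrow>\<^sub>L 'a) \<Rightarrow> int \<Rightarrow> 'a set" where
  "unstable_space P2 n = range (blinfun_apply (P2 n))"

definition centre_space :: "(int \<Rightarrow> 'a::real_normed_vector \<Rightarrow>\<^sub>L 'a) \<Rightarrow> int \<Rightarrow> 'a set" where
  "centre_space P3 n = range (blinfun_apply (P3 n))"

definition su_space ::
    "(int \<Rightarrow> 'a::real_normed_vector \<Rightarrow>\<^sub>L 'a) \<Rightarrow> (int \<Rightarrow> 'a \<Rightarrow>\<^sub>L 'a) \<Rightarrow> int \<Rightarrow> 'a set" where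
  "su_space P1 P2 n = {u + v |u v. u \<in> stable_space P1 n \<and> v \<in> unstable_space P2 n}"

text \<open>The suprema are finite, hence meaningful, for bounded \<open>z\<close>: under a strong partial dichotomy
  the estimates with \<open>m = n\<close> bound the norms of the \<open>P3 n\<close> uniformly in \<open>n\<close>.\<close>

definition split_sup_norm ::
    "(int \<Rightarrow> 'a::real_normed_vector \<Rightarrow>\<^sub>L 'a) \<Rightarrow> (int \<Rightarrow> 'a) \<Rightarrow> real" where
  "split_sup_norm P3 z =
     max (SUP n. norm (centre_part P3 n (z n))) (SUP n. norm (su_part P3 n (z n)))"

text \<open>The smallness of the pseudo-orbit defect is stated pointwise, since \<open>y\<close> is arbitrary and the
  real-valued supremum of an unbounded set is unspecified.\<close>

definition lipschitz_quasi_shadowing ::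
    "(int \<Rightarrow> 'a::real_normed_vector \<Rightarrow>\<^sub>L 'a) \<Rightarrow> (int \<Rightarrow> 'a \<Rightarrow>\<^sub>L 'a) \<Rightarrow> real \<Rightarrow> bool" where
  "lipschitz_quasi_shadowing A P3 L \<longleftrightarrow>
     (\<forall>\<epsilon>>0. \<forall>y :: int \<Rightarrow> 'a.
        (\<forall>n. norm (y (n + 1) - blinfun_apply (A n) (y n)) \<le> L * \<epsilon>) \<longrightarrow>
        (\<exists>z :: int \<Rightarrow> 'a. bounded (range z) \<and> split_sup_norm P3 z \<le> \<epsilon> \<and>
           (let x = (\<lambda>n. y n + su_part P3 n (z n)) in
            \<forall>n. x (n + 1) = blinfun_apply (A n) (x n) + centre_part P3 (n + 1) (z (n + 1)))))"

end

theory Submission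
  imports Defs
begin

text \<open>Apply the quasi-shadowing property to the orbit of \<open>F\<close> through \<open>(m, x)\<close>, whose defect with
  respect to \<open>A\<close> is \<open>f\<close>, and read off \<open>h m x - x\<close> and \<open>\<tau> m x\<close> as the stable-unstable and centre
  parts of the correction \<open>z\<close> at time \<open>m\<close>. As the correction depends on the orbit only, the
  conjugacy equation is the shadowing equation. For continuity: the centre part of \<open>z\<close> is the
  centre part of the defect; its stable (unstable) part satisfies an inhomogeneous linear
  recursion, so it is the uniform limit of the continuous functions obtained by iterating that
  recursion from the remote past (future), where the dichotomy suppresses the remainder.\<close>

section \<open>Projections and invertible operators\<close>

text \<open>Idempotence of \<open>R = Id - P - Q\<close> gives \<open>PQ + QP = 0\<close>. Composing
  with \<open>P\<close> on the left and on the right shows that \<open>PQ\<close> and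
  \<open>QP\<close> both equal \<open>-PQP\<close>; hence \<open>2 PQ = 0\<close>.\<close>

lemma idempotents_sum_id_orthogonal:
  fixes P Q R :: "'a::real_normed_vector \<Rightarrow>\<^sub>L 'a"
  assumes P: "P o\<^sub>L P = P" and Q: "Q o\<^sub>L Q = Q" and R: "R o\<^sub>L R = R"
    and sum: "P + Q + R = id_blinfun"
  shows "P (Q x) = 0"
proof -
  have PP: "P (P v) = P v" and QQ: "Q (Q v) = Q v" and RR: "R (R v) = R v" for v
    using P Q R by (metis blinfun_apply_blinfun_compose)+
  have Rv: "R v = v - P v - Q v" for v
    using arg_cong[OF sum, of "\<lambda>T. blinfun_apply T v"]
    by (simp add: blinfun.add_left algebra_simps)
  have anti: "P (Q v) + Q (P v) = 0" for v
    using RR[of v] unfolding Rv by (simp add: blinfun.diff_right PP QQ)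
  have "P (Q x) + P (Q (P x)) = 0"
    using arg_cong[OF anti[of x], of P] by (simp add: blinfun.add_right PP)
  moreover have "P (Q (P x)) + Q (P x) = 0"
    using anti[of "P x"] by (simp add: PP)
  ultimately have "P (Q x) = Q (P x)"
    by (metis add.commute add_left_cancel)
  with anti[of x] have "2 *\<^sub>R P (Q x) = 0"
    by (simp add: scaleR_2)
  then show ?thesis by simp
qed

lemma blinfun_inv_inverse:
  fixes T :: "'a::real_normed_vector \<Rightarrow>\<^sub>L 'a"
  assumes "blinfun_invertible T"
  shows "blinfun_inv T (T x) = x" and "T (blinfun_inv T x) = x"
proof -
  obtain S where S: "S o\<^sub>L T = id_blinfun" "T o\<^sub>L S = id_blinfun"
    using assms unfolding blinfun_invertible_def by blast
  have "blinfun_inv T o\<^sub>L T = id_blinfun \<and> T o\<^sub>L blinfun_inv T = id_blinfun"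
    unfolding blinfun_inv_def
  proof (rule theI)
    show "S o\<^sub>L T = id_blinfun \<and> T o\<^sub>L S = id_blinfun" using S by simp
  next
    fix S' assume S': "S' o\<^sub>L T = id_blinfun \<and> T o\<^sub>L S' = id_blinfun"
    show "S' = S"
    proof (rule blinfun_eqI)
      fix x
      have "S' x = S' (T (S x))"
        using S(2) by (metis blinfun_apply_blinfun_compose blinfun_apply_id_blinfun)
      also have "\<dots> = S x"
        using S' by (metis blinfun_apply_blinfun_compose blinfun_apply_id_blinfun)
      finally show "S' x = S x" .
    qed
  qed
  then show "blinfun_inv T (T x) = x" and "T (blinfun_inv T x) = x"
    by (metis blinfun_apply_blinfun_compose blinfun_apply_id_blinfun)+
qed

lemma blinfun_invertible_compose:
  assumes "blinfun_invertible S" "blinfun_invertible T"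
  shows "blinfun_invertible (S o\<^sub>L T)"
  unfolding blinfun_invertible_def
  by (intro exI[of _ "blinfun_inv T o\<^sub>L blinfun_inv S"] conjI blinfun_eqI)
    (simp_all add: blinfun_inv_inverse assms)

lemma blinfun_invertible_iterate_from:
  assumes "\<And>m. blinfun_invertible (A m)"
  shows "blinfun_invertible (iterate_from A n k)"
proof (induction k)
  case 0
  show ?case by (auto simp: blinfun_invertible_def intro!: exI[of _ id_blinfun] blinfun_eqI)
next
  case (Suc k)
  then show ?case by (simp add: assms blinfun_invertible_compose)
qed

section \<open>Continuity from linear recursions and uniform limits\<close>

text \<open>Discrete variation of constants: the difference is a finite sum of evolved values of the
  \<open>g n\<close>. Hence it is continuous although no continuity of \<open>w\<close> is
  assumed.\<close>

lemma iterate_from_recursion_continuous: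
  fixes A :: "int \<Rightarrow> 'a::real_normed_vector \<Rightarrow>\<^sub>L 'a"
    and w g :: "int \<Rightarrow> 'b::topological_space \<Rightarrow> 'a"
  assumes rec: "\<And>n x. w (n + 1) x = A n (w n x) + g n x"
    and cont: "\<And>n. continuous_on UNIV (g n)"
  shows "continuous_on UNIV (\<lambda>x. w (n + int k) x - iterate_from A n k (w n x))"
proof (induction k)
  case (Suc k)
  have "w (n + int (Suc k)) x - iterate_from A n (Suc k) (w n x) =
      A (n + int k) (w (n + int k) x - iterate_from A n k (w n x)) + g (n + int k) x" for x
    using rec[of "n + int k" x] by (simp add: blinfun.diff_right algebra_simps)
  then show ?case
    by (simp only:) (intro continuous_intros Suc cont)
qed simp

lemma continuous_on_exp_approx:
  fixes g :: "'a::topological_space \<Rightarrow> 'b::real_normed_vector" and \<phi> :: "nat \<Rightarrow> 'a \<Rightarrow> 'b"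
  assumes cont: "\<And>k. continuous_on S (\<phi> k)"
    and bound: "\<And>k x. x \<in> S \<Longrightarrow> norm (g x - \<phi> k x) \<le> C * exp (- r * real k)"
    and "r > 0"
  shows "continuous_on S g"
proof (rule uniform_limit_theorem)
  show "\<forall>\<^sub>F k in sequentially. continuous_on S (\<phi> k)" using cont by simp
  show "uniform_limit S \<phi> g sequentially"
  proof (rule uniform_limitI)
    fix e :: real assume "e > 0"
    have "(\<lambda>k. C * exp (- r) ^ k) \<longlonglongrightarrow> C * 0"
      using \<open>r > 0\<close> by (intro tendsto_mult tendsto_const LIMSEQ_power_zero) simp
    then have "(\<lambda>k. C * exp (- r * real k)) \<longlonglongrightarrow> 0"
      by (simp add: exp_of_nat_mult[symmetric] mult.commute)
    with \<open>e > 0\<close> have "\<forall>\<^sub>F k in sequentially. C * exp (- r * real k) < e"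
      by (auto dest: order_tendstoD(2))
    then show "\<forall>\<^sub>F k in sequentially. \<forall>x\<in>S. dist (\<phi> k x) (g x) < e"
      by eventually_elim (metis bound dist_commute dist_norm le_less_trans)
  qed
qed simp

section \<open>Perturbed maps and their orbits\<close>

text \<open>Smallness of \<open>c\<close> makes \<open>f\<close> followed by the inverse of
  \<open>T\<close> a contraction with factor 1/2. This bounds \<open>F\<close> from below, giving
  injectivity and a Lipschitz inverse, and yields surjectivity by Banach's fixed point
  theorem.\<close>

lemma homeomorphism_lipschitz_perturbation:
  fixes T :: "'a::banach \<Rightarrow>\<^sub>L 'a" and f F :: "'a \<Rightarrow> 'a"
  assumes inv: "blinfun_invertible T" and K: "norm (blinfun_inv T) \<le> K"
    and lip: "\<And>x y. norm (f x - f y) \<le> c * norm (x - y)"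
    and "c \<ge> 0" and cK: "c * K \<le> 1/2" and F: "\<And>x. F x = T x + f x"
  shows "\<exists>G. homeomorphism UNIV UNIV F G"
proof -
  let ?S = "blinfun_inv T"
  have S: "norm (?S v) \<le> K * norm v" for v
    using norm_blinfun[of ?S v] K by (meson mult_right_mono norm_ge_zero order_trans)
  have contr: "norm (?S (f x - f y)) \<le> 1/2 * norm (x - y)" for x y
  proof -
    have "K \<ge> 0" using K norm_ge_zero order_trans by blast
    have "norm (?S (f x - f y)) \<le> K * (c * norm (x - y))"
      using S lip \<open>K \<ge> 0\<close> by (meson mult_left_mono order_trans)
    also have "\<dots> = (c * K) * norm (x - y)" by simp
    also have "\<dots> \<le> 1/2 * norm (x - y)" using cK by (intro mult_right_mono) auto
    finally show ?thesis .
  qed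
  have lower: "norm (x - y) \<le> 2 * K * norm (F x - F y)" for x y
  proof -
    have "x - y = ?S (T x - T y)"
      by (simp add: blinfun.diff_right blinfun_inv_inverse[OF inv])
    also have "\<dots> = ?S (F x - F y) - ?S (f x - f y)"
      unfolding F by (simp add: blinfun.diff_right blinfun.add_right)
    finally have "norm (x - y) \<le> norm (?S (F x - F y)) + norm (?S (f x - f y))"
      by (metis norm_triangle_ineq4)
    with S[of "F x - F y"] contr[of x y] show ?thesis by simp
  qed
  have "inj F"
  proof (rule injI)
    show "x = y" if "F x = F y" for x y using lower[of x y] that by simp
  qed
  have surj: "\<exists>x. F x = y" for y
  proof -
    have "\<exists>!x. ?S (y - f x) = x"
    proof (intro banach_fix_type[of "1/2"] allI)
      fix u v :: 'a
      show "dist (?S (y - f u)) (?S (y - f v)) \<le> 1/2 * dist u v"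
        using contr[of v u] by (simp add: dist_norm blinfun.diff_right norm_minus_commute)
    qed auto
    then obtain x where "?S (y - f x) = x" by blast
    then have "T x = y - f x" using blinfun_inv_inverse(2)[OF inv, of "y - f x"] by simp
    then show ?thesis unfolding F by (intro exI[of _ x]) simp
  qed
  let ?G = "inv F"
  have FG: "F (?G y) = y" for y using surj by (metis surjI surj_f_inv_f surj_def)
  have GF: "?G (F x) = x" for x using \<open>inj F\<close> by simp
  have "c-lipschitz_on UNIV f"
    by (rule lipschitz_onI) (simp_all add: dist_norm lip \<open>c \<ge> 0\<close>)
  then have "continuous_on UNIV f" by (rule lipschitz_on_continuous_on)
  then have "continuous_on UNIV F" unfolding F by (intro continuous_intros)
  moreover have "(2 * K)-lipschitz_on UNIV ?G"
  proof (rule lipschitz_onI)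
    show "0 \<le> 2 * K" using K norm_ge_zero[of ?S] by linarith
    show "dist (?G x) (?G y) \<le> 2 * K * dist x y" for x y
      using lower[of "?G x" "?G y"] by (simp add: FG dist_norm)
  qed
  then have "continuous_on UNIV ?G" by (rule lipschitz_on_continuous_on)
  ultimately have "homeomorphism UNIV UNIV F ?G"
    by (intro homeomorphismI) (auto simp: FG GF)
  then show ?thesis by blast
qed

text \<open>The last property lets anything chosen per orbit be read at consecutive base points,
  which is how the conjugacy equation arises.\<close>

lemma orbit_of_homeomorphisms:
  fixes F :: "int \<Rightarrow> 'a::topological_space \<Rightarrow> 'a"
  assumes "\<And>n. \<exists>G. homeomorphism UNIV UNIV (F n) G"
  obtains orb :: "int \<Rightarrow> 'a \<Rightarrow> int \<Rightarrow> 'a"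
  where "\<And>m x. orb m x m = x"
    and "\<And>m x n. orb m x (n + 1) = F n (orb m x n)"
    and "\<And>m n. continuous_on UNIV (\<lambda>x. orb m x n)"
    and "\<And>m x. orb (m + 1) (F m x) = orb m x"
proof -
  obtain G where G: "\<And>n. homeomorphism UNIV UNIV (F n) (G n)" using assms by metis
  have FG: "F n (G n x) = x" and GF: "G n (F n x) = x" for n x
    using G[of n] by (auto simp: homeomorphism_def)
  have cF: "continuous_on UNIV (F n)" and cG: "continuous_on UNIV (G n)" for n
    using G[of n] by (auto simp: homeomorphism_def)
  define fw where "fw m x = rec_nat x (\<lambda>k. F (m + int k))" for m x
  \<comment> \<open>After \<open>k\<close> backward steps the time is \<open>m - k\<close>; since
    \<open>F n\<close> leads from time \<open>n\<close> to \<open>n + 1\<close>, the next step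
    inverts \<open>F\<close> at index \<open>m - k - 1\<close>.\<close>
  define bw where "bw m x = rec_nat x (\<lambda>k. G (m - int k - 1))" for m x
  have fw: "fw m x 0 = x" "fw m x (Suc k) = F (m + int k) (fw m x k)" for m x k
    by (simp_all add: fw_def)
  have bw: "bw m x 0 = x" "bw m x (Suc k) = G (m - int k - 1) (bw m x k)" for m x k
    by (simp_all add: bw_def)
  define orb where "orb m x n = (if m \<le> n then fw m x (nat (n - m)) else bw m x (nat (m - n)))"
    for m x n
  have start: "orb m x m = x" for m x by (simp add: orb_def fw)
  have step: "orb m x (n + 1) = F n (orb m x n)" for m x n
  proof (cases "m \<le> n")
    case True
    then have "nat (n + 1 - m) = Suc (nat (n - m))" by simp
    then show ?thesis using True by (simp add: orb_def fw)
  next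
    case False
    \<comment> \<open>\<open>k\<close> backward steps lead to time \<open>n + 1\<close>, and one
      more, through \<open>G n\<close>, leads to \<open>n\<close>. For \<open>m = n + 1\<close> the
      value at \<open>n + 1\<close> falls under the forward branch.\<close>
    define k where "k = nat (m - (n + 1))"
    have "nat (m - n) = Suc k" "m - int k - 1 = n" using False by (auto simp: k_def)
    then have "F n (orb m x n) = bw m x k" using False by (simp add: orb_def bw FG)
    moreover have "orb m x (n + 1) = bw m x k"
    proof (cases "m = n + 1")
      case True
      then show ?thesis by (simp add: orb_def k_def fw bw)
    next
      case False
      with \<open>\<not> m \<le> n\<close> show ?thesis by (simp add: orb_def k_def)
    qed
    ultimately show ?thesis by simp
  qed
  have "continuous_on UNIV (\<lambda>x. fw m x k)" for m k
    by (induction k) (auto simp: fw intro: continuous_on_compose2[OF cF])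
  moreover have "continuous_on UNIV (\<lambda>x. bw m x k)" for m k
    by (induction k) (auto simp: bw intro: continuous_on_compose2[OF cG])
  ultimately have cont: "continuous_on UNIV (\<lambda>x. orb m x n)" for m n
    by (cases "m \<le> n") (simp_all add: orb_def)
  have shift: "orb (m + 1) (F m x) = orb m x" for m x
  proof
    fix n
    show "orb (m + 1) (F m x) n = orb m x n"
    \<comment> \<open>Both sides solve the same recursion and agree at time \<open>m + 1\<close>.
      Downwards, the left inverse of \<open>F (i - 1)\<close> cancels the recursion step.\<close>
    proof (induction n rule: int_induct[where k = "m + 1"])
      case base
      show ?case by (simp add: start step)
    next
      case (step1 i)
      then show ?case by (simp add: step)
    next
      case (step2 i)
      then show ?case using step[of "m + 1" "F m x" "i - 1"] step[of m x "i - 1"]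
        by (metis GF diff_add_cancel)
    qed
  qed
  show thesis using that start step cont shift by blast
qed

section \<open>Quantitative consequences of the assumptions\<close>

text \<open>A real supremum is sure to dominate its family only if the family is bounded above; the
  bounds on \<open>z\<close> and on the centre projections ensure this for both parts.\<close>

lemma split_sup_norm_le_imp:
  assumes "split_sup_norm P3 z \<le> \<epsilon>" and "bounded (range z)" and P3: "\<And>n. norm (P3 n) \<le> D"
  shows "norm (centre_part P3 n (z n)) \<le> \<epsilon>" and "norm (su_part P3 n (z n)) \<le> \<epsilon>"
proof -
  obtain B where B: "\<And>n. norm (z n) \<le> B" using \<open>bounded (range z)\<close> by (auto simp: bounded_iff)
  have c: "norm (centre_part P3 n (z n)) \<le> D * B" for n
  proof -
    have "norm (centre_part P3 n (z n)) \<le> norm (P3 n) * norm (z n)"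
      unfolding centre_part_def by (rule norm_blinfun)
    also have "\<dots> \<le> D * B"
      using P3 B by (intro mult_mono) (auto intro: order_trans[OF norm_ge_zero])
    finally show ?thesis .
  qed
  have su: "norm (su_part P3 n (z n)) \<le> B + D * B" for n
    using norm_triangle_ineq4[of "z n" "centre_part P3 n (z n)"] c[of n] B[of n]
    by (simp add: su_part_def)
  have "norm (centre_part P3 n (z n)) \<le> (SUP n. norm (centre_part P3 n (z n)))"
    by (rule cSUP_upper) (auto intro: bdd_aboveI2 c)
  moreover have "norm (su_part P3 n (z n)) \<le> (SUP n. norm (su_part P3 n (z n)))"
    by (rule cSUP_upper) (auto intro: bdd_aboveI2 su)
  ultimately show "norm (centre_part P3 n (z n)) \<le> \<epsilon>" and "norm (su_part P3 n (z n)) \<le> \<epsilon>"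
    using assms(1) by (auto simp: split_sup_norm_def)
qed

text \<open>Positivity of \<open>b\<close> and \<open>d\<close> follows from
  \<open>b > a \<ge> 0\<close> and \<open>d > c \<ge> 0\<close>; the bound on \<open>P3 n\<close> is
  the centre estimate at \<open>m = n\<close>, where the evolution is the identity.\<close>

lemma strong_partial_dichotomy_estimates:
  fixes A P1 P2 P3 :: "int \<Rightarrow> 'a::real_normed_vector \<Rightarrow>\<^sub>L 'a"
  assumes "strong_partial_dichotomy A P1 P2 P3"
  obtains D b d :: real where "b > 0" and "d > 0"
    and "\<And>m n. n \<le> m \<Longrightarrow> norm (evol A m n o\<^sub>L P1 n) \<le> D * exp (- d * real_of_int (m - n))"
    and "\<And>m n. m \<le> n \<Longrightarrow> norm (evol A m n o\<^sub>L P2 n) \<le> D * exp (- b * real_of_int (n - m))"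
    and "\<And>n. norm (P3 n) \<le> D"
proof -
  obtain D a b c d :: real where bounds: "0 \<le> a" "a < b" "0 \<le> c" "c < d"
    and fw: "\<forall>m n. m \<ge> n \<longrightarrow>
        norm (evol A m n o\<^sub>L P1 n) \<le> D * exp (- d * real_of_int (m - n)) \<and>
        norm (evol A m n o\<^sub>L P3 n) \<le> D * exp (a * real_of_int (m - n))"
    and bw: "\<forall>m n. m \<le> n \<longrightarrow>
        norm (evol A m n o\<^sub>L P2 n) \<le> D * exp (- b * real_of_int (n - m)) \<and>
        norm (evol A m n o\<^sub>L P3 n) \<le> D * exp (c * real_of_int (n - m))"
    using assms unfolding strong_partial_dichotomy_def
    by (elim conjE exE) (rule that, assumption+)
  have "evol A n n o\<^sub>L P3 n = P3 n" for n
    by (simp add: evol_def blinfun_eqI)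
  then have "norm (P3 n) \<le> D" for n
    using fw[rule_format, of n n] by simp
  with bounds fw bw show thesis
    by (intro that[of b d D]) auto
qed

lemma strong_partial_dichotomy_su_part:
  assumes "strong_partial_dichotomy A P1 P2 P3"
  shows "su_part P3 n v = P1 n v + P2 n v"
proof -
  have "P1 n + P2 n + P3 n = id_blinfun"
    using assms by (simp add: strong_partial_dichotomy_def)
  from arg_cong[OF this, of "\<lambda>T. blinfun_apply T v"] show ?thesis
    by (simp add: su_part_def centre_part_def blinfun.add_left algebra_simps)
qed

section \<open>Continuity of the shadowing correction\<close>

text \<open>A correction picked by choice need not depend continuously on \<open>x\<close>. Here the
  equation fixes its centre part, and the bound \<open>M\<close>, uniform in \<open>x\<close> and
  \<open>n\<close>, together with the dichotomy determines the other two parts.\<close>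

lemma quasi_shadowing_correction_continuous:
  fixes A P1 P2 P3 :: "int \<Rightarrow> 'a::real_normed_vector \<Rightarrow>\<^sub>L 'a"
    and y z :: "'b::topological_space \<Rightarrow> int \<Rightarrow> 'a"
  assumes inv: "\<And>m. blinfun_invertible (A m)"
    and dich: "strong_partial_dichotomy A P1 P2 P3"
    and eq: "\<And>x n. y x (n + 1) + su_part P3 (n + 1) (z x (n + 1)) =
      A n (y x n + su_part P3 n (z x n)) + centre_part P3 (n + 1) (z x (n + 1))"
    and cont: "\<And>n. continuous_on UNIV (\<lambda>x. y x n)"
    and bound: "\<And>x n. norm (z x n) \<le> M"
  shows "continuous_on UNIV (\<lambda>x. centre_part P3 m (z x m))"
    and "continuous_on UNIV (\<lambda>x. su_part P3 m (z x m))"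
proof -
  note D = dich[unfolded strong_partial_dichotomy_def]
  have idem: "P1 n o\<^sub>L P1 n = P1 n" "P2 n o\<^sub>L P2 n = P2 n" "P3 n o\<^sub>L P3 n = P3 n"
    and sum: "P1 n + P2 n + P3 n = id_blinfun" for n
    using D by blast+
  have comm: "P1 (n + 1) (A n v) = A n (P1 n v)" "P2 (n + 1) (A n v) = A n (P2 n v)"
    "P3 (n + 1) (A n v) = A n (P3 n v)" for n v
    using D by (metis blinfun_apply_blinfun_compose)+
  obtain D b d where "b > 0" "d > 0"
    and est1: "\<And>m n. n \<le> m \<Longrightarrow> norm (evol A m n o\<^sub>L P1 n) \<le> D * exp (- d * real_of_int (m - n))"
    and est2: "\<And>m n. m \<le> n \<Longrightarrow> norm (evol A m n o\<^sub>L P2 n) \<le> D * exp (- b * real_of_int (n - m))"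
    by (rule strong_partial_dichotomy_estimates[OF dich]) (rule that)
  have [simp]: "P1 n (P1 n v) = P1 n v" "P2 n (P2 n v) = P2 n v" "P3 n (P3 n v) = P3 n v" for n v
    using idem by (metis blinfun_apply_blinfun_compose)+
  \<comment> \<open>Orthogonality is stated for the first two summands of the identity, in that
    order; the six orders of the sum serve the six mixed products.\<close>
  have perm: "P1 n + P2 n + P3 n = id_blinfun" "P2 n + P1 n + P3 n = id_blinfun"
    "P1 n + P3 n + P2 n = id_blinfun" "P3 n + P1 n + P2 n = id_blinfun"
    "P2 n + P3 n + P1 n = id_blinfun" "P3 n + P2 n + P1 n = id_blinfun" for n
    using sum[of n] by (simp_all add: ac_simps)
  have [simp]: "P1 n (P2 n v) = 0" "P2 n (P1 n v) = 0" "P3 n (P1 n v) = 0"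
    "P1 n (P3 n v) = 0" "P2 n (P3 n v) = 0" "P3 n (P2 n v) = 0" for n v
    by (rule idempotents_sum_id_orthogonal, rule idem, rule idem, rule idem, rule perm)+
  note su = strong_partial_dichotomy_su_part[OF dich]
  define g where "g n x = A n (y x n) - y x (n + 1)" for n x
  have cont_g: "continuous_on UNIV (g n)" for n
    unfolding g_def by (intro continuous_intros cont)
  have eq': "P1 (n + 1) (z x (n + 1)) + P2 (n + 1) (z x (n + 1)) =
      A n (P1 n (z x n) + P2 n (z x n)) + P3 (n + 1) (z x (n + 1)) + g n x" for n x
    using eq[of x n] by (simp add: su centre_part_def g_def blinfun.add_right algebra_simps)
  \<comment> \<open>The projections commute with the evolution and annihilate each other, so
    projecting at time \<open>n + 1\<close> decouples the equation. In the centre direction no term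
    from time \<open>n\<close> survives.\<close>
  have rec1: "P1 (n + 1) (z x (n + 1)) = A n (P1 n (z x n)) + P1 (n + 1) (g n x)" for n x
    using arg_cong[OF eq'[where n = n and x = x], of "P1 (n + 1)"]
    by (simp add: blinfun.add_right comm)
  have rec2: "P2 (n + 1) (z x (n + 1)) = A n (P2 n (z x n)) + P2 (n + 1) (g n x)" for n x
    using arg_cong[OF eq'[where n = n and x = x], of "P2 (n + 1)"]
    by (simp add: blinfun.add_right comm)
  have rec3: "P3 (n + 1) (z x (n + 1)) = - P3 (n + 1) (g n x)" for n x
    using arg_cong[OF eq'[where n = n and x = x], of "P3 (n + 1)"]
    by (simp add: blinfun.add_right comm eq_neg_iff_add_eq_0)
  have "P3 m (z x m) = - P3 m (g (m - 1) x)" for x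
    using rec3[of "m - 1" x] by simp
  then show "continuous_on UNIV (\<lambda>x. centre_part P3 m (z x m))"
    unfolding centre_part_def by (simp only:) (intro continuous_intros cont_g)
  have "D \<ge> 0"
    using order_trans[OF norm_ge_zero est1[of 0 0]] by simp
  have remainder: "norm ((E o\<^sub>L Q) (z x n)) \<le> D * M * exp r" if "norm (E o\<^sub>L Q) \<le> D * exp r"
    for E Q :: "'a \<Rightarrow>\<^sub>L 'a" and x n r
  proof -
    have "norm ((E o\<^sub>L Q) (z x n)) \<le> norm (E o\<^sub>L Q) * norm (z x n)" by (rule norm_blinfun)
    also have "\<dots> \<le> D * exp r * M" using that bound \<open>D \<ge> 0\<close> by (intro mult_mono) auto
    finally show ?thesis by (simp add: mult_ac)
  qed
  have "continuous_on UNIV (\<lambda>x. P1 m (z x m))"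
  proof (rule continuous_on_exp_approx[OF _ _ \<open>d > 0\<close>])
    fix k :: nat
    let ?n = "m - int k"
    \<comment> \<open>What \<open>?\<phi>\<close> omits from the stable part at \<open>m\<close> is
      the evolved stable part of \<open>z\<close> at \<open>m - k\<close>, which decays at rate
      \<open>d\<close> uniformly in \<open>x\<close>.\<close>
    let ?\<phi> = "\<lambda>x. P1 m (z x m) - iterate_from A ?n k (P1 ?n (z x ?n))"
    show "continuous_on UNIV ?\<phi>"
      using iterate_from_recursion_continuous[of "\<lambda>n x. P1 n (z x n)" A
          "\<lambda>n x. P1 (n + 1) (g n x)" ?n k, OF rec1]
      by (simp add: continuous_intros cont_g)
    show "norm (P1 m (z x m) - ?\<phi> x) \<le> D * M * exp (- d * real k)" for x
      using remainder[OF est1[of ?n m], of x ?n] by (simp add: evol_def)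
  qed
  moreover have "continuous_on UNIV (\<lambda>x. P2 m (z x m))"
  proof (rule continuous_on_exp_approx[OF _ _ \<open>b > 0\<close>])
    fix k :: nat
    let ?n = "m + int k"
    let ?I = "blinfun_inv (iterate_from A m k)"
    \<comment> \<open>The recursion from \<open>m\<close> to \<open>m + k\<close> is solved for its
      initial value: the unstable part at \<open>m\<close> equals \<open>?\<phi>\<close> plus the
      pullback of the unstable part at \<open>m + k\<close>, which decays at rate
      \<open>b\<close>.\<close>
    let ?\<phi> = "\<lambda>x. - ?I (P2 ?n (z x ?n) - iterate_from A m k (P2 m (z x m)))"
    have I: "?I (iterate_from A m k v) = v" for v
      by (intro blinfun_inv_inverse blinfun_invertible_iterate_from inv)
    \<comment> \<open>At \<open>k = 0\<close> the definition of \<open>evol\<close> takes its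
      forward branch, so there the inverse of the identity has to be computed.\<close>
    have "?I = evol A m ?n"
    proof (cases "k = 0")
      case True
      then show ?thesis using I by (auto simp: evol_def intro!: blinfun_eqI)
    next
      case False
      then show ?thesis by (simp add: evol_def)
    qed
    then have "norm (?I (P2 ?n (z x ?n))) \<le> D * M * exp (- b * real k)" for x
      using remainder[OF est2[of m ?n], of x ?n] by simp
    then show "norm (P2 m (z x m) - ?\<phi> x) \<le> D * M * exp (- b * real k)" for x
      by (simp add: blinfun.diff_right I)
    have "continuous_on UNIV (\<lambda>x. P2 ?n (z x ?n) - iterate_from A m k (P2 m (z x m)))"
      using iterate_from_recursion_continuous[of "\<lambda>n x. P2 n (z x n)" A
          "\<lambda>n x. P2 (n + 1) (g n x)" m k, OF rec2]
      by (simp add: continuous_intros cont_g)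
    then show "continuous_on UNIV ?\<phi>"
      by (intro continuous_on_minus bounded_linear.continuous_on[OF blinfun.bounded_linear_right])
  qed
  ultimately show "continuous_on UNIV (\<lambda>x. su_part P3 m (z x m))"
    unfolding su by (intro continuous_on_add)
qed

section \<open>Construction of the conjugacy from the corrections\<close>

theorem theorem3:
  fixes A P1 P2 P3 :: "int \<Rightarrow> 'a::banach \<Rightarrow>\<^sub>L 'a" and L :: real
  assumes "\<And>m. blinfun_invertible (A m)"
    and "bdd_above (range (\<lambda>m. norm (A m)) \<union> range (\<lambda>m. norm (blinfun_inv (A m))))"
    and "strong_partial_dichotomy A P1 P2 P3"
    and "L > 0"
    and "lipschitz_quasi_shadowing A P3 L"
  shows "\<exists>\<epsilon>0>0. \<forall>\<epsilon>. 0 < \<epsilon> \<and> \<epsilon> \<le> \<epsilon>0 \<longrightarrow>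
    (\<exists>c0>0. \<forall>c. 0 < c \<and> c \<le> c0 \<longrightarrow>
      (\<forall>f F :: int \<Rightarrow> 'a \<Rightarrow> 'a.
        (\<forall>n x y. norm (f n x - f n y) \<le> c * norm (x - y)) \<and>
        (\<forall>n x. norm (f n x) \<le> L * \<epsilon>) \<and>
        (\<forall>n x. F n x = blinfun_apply (A n) x + f n x) \<longrightarrow>
        (\<forall>n. \<exists>G. homeomorphism UNIV UNIV (F n) G) \<and>
        (\<exists>h \<tau> :: int \<Rightarrow> 'a \<Rightarrow> 'a.
          (\<forall>m. continuous_on UNIV (h m)) \<and>
          (\<forall>m. continuous_on UNIV (\<tau> m)) \<and>
          (\<forall>m x. \<tau> m x \<in> centre_space P3 m) \<and>
          (\<forall>m x. h (m + 1) (F m x) = blinfun_apply (A m) (h m x) + \<tau> (m + 1) (F m x)) \<and>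
          (\<forall>m x. norm (h m x - x) \<le> \<epsilon>) \<and>
          (\<forall>m x. norm (\<tau> m x) \<le> \<epsilon>) \<and>
          (\<forall>m x. h m x - x \<in> su_space P1 P2 m))))"
proof -
  have "\<exists>D. \<forall>n. norm (P3 n) \<le> D"
    by (rule strong_partial_dichotomy_estimates[OF assms(3)]) (intro exI allI)
  then obtain D where P3: "\<And>n. norm (P3 n) \<le> D" by blast
  have su: "su_part P3 n v \<in> su_space P1 P2 n" for n v
    by (auto simp: strong_partial_dichotomy_su_part[OF assms(3)]
        su_space_def stable_space_def unstable_space_def)
  obtain K where K: "\<And>m. norm (blinfun_inv (A m)) \<le> K"
    using assms(2) by (auto simp: bdd_above_def ball_Un)
  \<comment> \<open>Chosen so that \<open>c \<le> c0\<close> gives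
    \<open>c * max K 1 \<le> 1/2\<close>. The maximum keeps the denominator positive even if
    \<open>K = 0\<close>, which the zero space allows.\<close>
  define c0 where "c0 = 1 / (2 * max K 1)"
  have "c0 > 0" by (simp add: c0_def)
  have main: "(\<forall>n. \<exists>G. homeomorphism UNIV UNIV (F n) G) \<and>
        (\<exists>h \<tau> :: int \<Rightarrow> 'a \<Rightarrow> 'a.
          (\<forall>m. continuous_on UNIV (h m)) \<and>
          (\<forall>m. continuous_on UNIV (\<tau> m)) \<and>
          (\<forall>m x. \<tau> m x \<in> centre_space P3 m) \<and>
          (\<forall>m x. h (m + 1) (F m x) = A m (h m x) + \<tau> (m + 1) (F m x)) \<and>
          (\<forall>m x. norm (h m x - x) \<le> \<epsilon>) \<and>
          (\<forall>m x. norm (\<tau> m x) \<le> \<epsilon>) \<and>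
          (\<forall>m x. h m x - x \<in> su_space P1 P2 m))"
    if "0 < \<epsilon>" and c: "0 < c" "c \<le> c0"
      and "\<forall>n x y. norm (f n x - f n y) \<le> c * norm (x - y)"
      and "\<forall>n x. norm (f n x) \<le> L * \<epsilon>" and "\<forall>n x. F n x = A n x + f n x"
    for \<epsilon> c and f F :: "int \<Rightarrow> 'a \<Rightarrow> 'a"
  proof -
    have lip: "norm (f n x - f n y) \<le> c * norm (x - y)" and small: "norm (f n x) \<le> L * \<epsilon>"
      and F: "F n x = A n x + f n x" for n x y
      using that by simp_all
    have "c * max K 1 \<le> c0 * max K 1" using c by (intro mult_right_mono) auto
    then have cK: "c * max K 1 \<le> 1/2" by (simp add: c0_def)
    have homeo: "\<exists>G. homeomorphism UNIV UNIV (F n) G" for n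
      by (rule homeomorphism_lipschitz_perturbation[OF assms(1) _ lip _ cK F])
        (use K[of n] c in auto)
    obtain orb where orb: "\<And>m x. orb m x m = x"
        "\<And>m x n. orb m x (n + 1) = F n (orb m x n)"
        "\<And>m n. continuous_on UNIV (\<lambda>x. orb m x n)"
        "\<And>m x. orb (m + 1) (F m x) = orb m x"
      using orbit_of_homeomorphisms[of F, OF homeo] by blast
    have "\<exists>z. bounded (range z) \<and> split_sup_norm P3 z \<le> \<epsilon> \<and>
        (\<forall>n. y (n + 1) + su_part P3 (n + 1) (z (n + 1)) =
          A n (y n + su_part P3 n (z n)) + centre_part P3 (n + 1) (z (n + 1)))"
      if "\<And>n. y (n + 1) = F n (y n)" for y
    proof -
      have "norm (y (n + 1) - A n (y n)) \<le> L * \<epsilon>" for n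
        using small by (simp add: that F)
      then show ?thesis
        using assms(5) \<open>0 < \<epsilon>\<close> unfolding lipschitz_quasi_shadowing_def Let_def by blast
    qed
    \<comment> \<open>The choice is indexed by the whole sequence, not by the pair
      \<open>(m, x)\<close>: equal orbits receive the same correction.\<close>
    then obtain Z where Z: "\<And>y. (\<And>n. y (n + 1) = F n (y n)) \<Longrightarrow> bounded (range (Z y)) \<and>
        split_sup_norm P3 (Z y) \<le> \<epsilon> \<and>
        (\<forall>n. y (n + 1) + su_part P3 (n + 1) (Z y (n + 1)) =
          A n (y n + su_part P3 n (Z y n)) + centre_part P3 (n + 1) (Z y (n + 1)))"
      by metis
    have bnd: "bounded (range (Z (orb m x)))" and sup: "split_sup_norm P3 (Z (orb m x)) \<le> \<epsilon>"
      and eq: "orb m x (n + 1) + su_part P3 (n + 1) (Z (orb m x) (n + 1)) =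
        A n (orb m x n + su_part P3 n (Z (orb m x) n)) +
        centre_part P3 (n + 1) (Z (orb m x) (n + 1))" for m x n
      using Z[of "orb m x"] by (simp_all add: orb(2))
    have c_le: "norm (centre_part P3 n (Z (orb m x) n)) \<le> \<epsilon>"
      and su_le: "norm (su_part P3 n (Z (orb m x) n)) \<le> \<epsilon>" for m x n
      by (rule split_sup_norm_le_imp[OF sup bnd P3])+
    have "norm (Z (orb m x) n) \<le> 2 * \<epsilon>" for m x n
      using norm_triangle_le[OF add_mono[OF c_le[of n m x] su_le[of n m x]]]
      by (simp add: su_part_def)
    note cont = quasi_shadowing_correction_continuous[OF assms(1,3) eq orb(3) this]
    define h where "h m x = x + su_part P3 m (Z (orb m x) m)" for m x
    define \<tau> where "\<tau> m x = centre_part P3 m (Z (orb m x) m)" for m x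
    have "continuous_on UNIV (h m)" "continuous_on UNIV (\<tau> m)" for m
      unfolding h_def \<tau>_def by (intro continuous_intros cont)+
    \<comment> \<open>The orbit passes through \<open>F m x\<close> at time \<open>m + 1\<close>,
      and \<open>orb(4)\<close> identifies the correction used there by \<open>h (m + 1)\<close> and
      \<open>\<tau> (m + 1)\<close> with the one used by \<open>h m\<close>.\<close>
    moreover have "h (m + 1) (F m x) = A m (h m x) + \<tau> (m + 1) (F m x)" for m x
      using eq[of m x m] by (simp add: h_def \<tau>_def orb(1,2,4))
    moreover have "norm (h m x - x) \<le> \<epsilon>" "norm (\<tau> m x) \<le> \<epsilon>" "h m x - x \<in> su_space P1 P2 m"
        "\<tau> m x \<in> centre_space P3 m" for m x
      by (simp_all add: h_def \<tau>_def su_le c_le su) (simp add: centre_part_def centre_space_def)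
    ultimately show ?thesis using homeo by blast
  qed
  \<comment> \<open>Quasi-shadowing holds at every scale and \<open>c0\<close> depends on
    \<open>K\<close> alone, so the threshold 1 for \<epsilon> is an arbitrary choice and one
    \<open>c0\<close> serves all \<epsilon>.\<close>
  show ?thesis
    by (rule exI[of _ "1::real"], intro conjI zero_less_one allI impI, rule exI[of _ c0],
        rule conjI, rule \<open>c0 > 0\<close>, intro allI impI, elim conjE, rule main, assumption+)
qed

end
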